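(* Let $N$ be a finite satisfiable MSLH clause set, and let $p$ be the number of predicate symbols occurring in $N$. Then $N$ has a finite model whose domain contains at most $2^p$ elements.
   Context: We work in first-order logic without equality. A clause is a finite multiset of literals, written as an implication $\Gamma \rightarrow \Delta$, where $\Gamma$ is the multiset of the atoms of its negative literals and $\Delta$ is the multiset of its positive literals; it stands for the universally quantified disjunction of its literals. A term is shallow if it is a constant, a variable, or of the form $f(x_1,\ldots,x_n)$ with variables $x_1,\ldots,x_n$. A term is linear if no variable occurs in it more than once. A clause $\Gamma \rightarrow \Delta$ is an MSLH (monadic shallow linear Horn) clause if (i) $\Delta$ contains at most one atom, (ii) all predicates occurring in the clause are monadic (exactly one argument), and (iii) the argument of any atom in $\Delta$ is shallow and linear. (The arguments of atoms in $\Gamma$ are arbitrary terms.) An MSLH clause set is a set of MSLH clauses. A model is an ordinary first-order structure with nonempty domain satisfying all clauses of the set. *)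

theory Defs
  imports "HOL-Library.Multiset"
begin

text \<open>
  A symbol is a name together with the number of arguments it is applied to, as usual for
  term types built on lists. Constants are terms \<open>Fun c []\<close>.
\<close>

datatype ('f, 'v) fo_term = Var 'v | Fun 'f "('f, 'v) fo_term list"

datatype ('f, 'p, 'v) atom = Atom (pred_of: 'p) (args: "('f, 'v) fo_term list")

datatype ('f, 'p, 'v) literal =
    is_Pos: Pos (atom_of: "('f, 'p, 'v) atom")
  | Neg (atom_of: "('f, 'p, 'v) atom")

text \<open>In a clause \<open>\<Gamma> \<rightarrow> \<Delta>\<close>, \<open>\<Delta>\<close> is the \<open>succedent\<close>.\<close>

type_synonym ('f, 'p, 'v) clause = "('f, 'p, 'v) literal multiset"

definition succedent :: "('f, 'p, 'v) clause \<Rightarrow> ('f, 'p, 'v) atom multiset" where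
  "succedent C = image_mset atom_of (filter_mset is_Pos C)"

fun shallow :: "('f, 'v) fo_term \<Rightarrow> bool" where
  "shallow (Var x) \<longleftrightarrow> True"
| "shallow (Fun f ts) \<longleftrightarrow> (\<forall>t \<in> set ts. \<exists>x. t = Var x)"

text \<open>The variable occurrences of a term from left to right, with repetitions.\<close>

primrec var_occs :: "('f, 'v) fo_term \<Rightarrow> 'v list" where
  "var_occs (Var x) = [x]"
| "var_occs (Fun f ts) = concat (map var_occs ts)"

definition linear :: "('f, 'v) fo_term \<Rightarrow> bool" where
  "linear t \<longleftrightarrow> distinct (var_occs t)"

definition monadic :: "('f, 'p, 'v) atom \<Rightarrow> bool" where
  "monadic A \<longleftrightarrow> length (args A) = 1"

definition mslh_clause :: "('f, 'p, 'v) clause \<Rightarrow> bool" where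
  "mslh_clause C \<longleftrightarrow>
     size (succedent C) \<le> 1 \<and>
     (\<forall>L \<in># C. monadic (atom_of L)) \<and>
     (\<forall>A \<in># succedent C. \<forall>t \<in> set (args A). shallow t \<and> linear t)"

definition mslh_clause_set :: "('f, 'p, 'v) clause set \<Rightarrow> bool" where
  "mslh_clause_set N \<longleftrightarrow> (\<forall>C \<in> N. mslh_clause C)"

definition preds :: "('f, 'p, 'v) clause set \<Rightarrow> 'p set" where
  "preds N = {pred_of (atom_of L) | L C. C \<in> N \<and> L \<in># C}"

record ('f, 'p, 'u) struct =
  universe :: "'u set"
  fun_interp :: "'f \<Rightarrow> 'u list \<Rightarrow> 'u"
  pred_interp :: "'p \<Rightarrow> 'u list \<Rightarrow> bool"

definition is_struct :: "('f, 'p, 'u) struct \<Rightarrow> bool" where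
  "is_struct M \<longleftrightarrow>
     universe M \<noteq> {} \<and>
     (\<forall>f us. set us \<subseteq> universe M \<longrightarrow> fun_interp M f us \<in> universe M)"

primrec eval_term :: "('f, 'p, 'u) struct \<Rightarrow> ('v \<Rightarrow> 'u) \<Rightarrow> ('f, 'v) fo_term \<Rightarrow> 'u" where
  "eval_term M \<alpha> (Var x) = \<alpha> x"
| "eval_term M \<alpha> (Fun f ts) = fun_interp M f (map (eval_term M \<alpha>) ts)"

definition sat_atom :: "('f, 'p, 'u) struct \<Rightarrow> ('v \<Rightarrow> 'u) \<Rightarrow> ('f, 'p, 'v) atom \<Rightarrow> bool" where
  "sat_atom M \<alpha> A \<longleftrightarrow> pred_interp M (pred_of A) (map (eval_term M \<alpha>) (args A))"

primrec sat_literal :: "('f, 'p, 'u) struct \<Rightarrow> ('v \<Rightarrow> 'u) \<Rightarrow> ('f, 'p, 'v) literal \<Rightarrow> bool" where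
  "sat_literal M \<alpha> (Pos A) \<longleftrightarrow> sat_atom M \<alpha> A"
| "sat_literal M \<alpha> (Neg A) \<longleftrightarrow> \<not> sat_atom M \<alpha> A"

definition sat_clause :: "('f, 'p, 'u) struct \<Rightarrow> ('f, 'p, 'v) clause \<Rightarrow> bool" where
  "sat_clause M C \<longleftrightarrow>
     (\<forall>\<alpha>. range \<alpha> \<subseteq> universe M \<longrightarrow> (\<exists>L \<in># C. sat_literal M \<alpha> L))"

definition is_model :: "('f, 'p, 'u) struct \<Rightarrow> ('f, 'p, 'v) clause set \<Rightarrow> bool" where
  "is_model M N \<longleftrightarrow> is_struct M \<and> (\<forall>C \<in> N. sat_clause M C)"

end

theory Submission imports Defs begin

text \<open>
  Take the least Herbrand model of the definite clauses of \<open>N\<close> and identify terms that satisfy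
  the same predicates. Because heads are shallow and linear, the subterms directly below the root
  of a derived atom can be exchanged independently of each other in the last derivation step, so
  this equivalence is a congruence and the quotient is a model. Its elements are determined by
  sets of predicates.
\<close>

primrec subst :: "('v \<Rightarrow> ('f, 'w) fo_term) \<Rightarrow> ('f, 'v) fo_term \<Rightarrow> ('f, 'w) fo_term" where
  "subst \<sigma> (Var x) = \<sigma> x"
| "subst \<sigma> (Fun f ts) = Fun f (map (subst \<sigma>) ts)"

lemma eval_term_subst:
  "eval_term M \<alpha> (subst \<sigma> t) = eval_term M (\<lambda>x. eval_term M \<alpha> (\<sigma> x)) t"
  by (induction t) (auto simp: o_def cong: map_cong)

lemma eval_term_in_universe:
  assumes "is_struct M" "range \<alpha> \<subseteq> universe M"
  shows "eval_term M \<alpha> t \<in> universe M"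
proof (induction t)
  case (Var x)
  then show ?case using assms(2) by auto
next
  case (Fun f ts)
  then have "set (map (eval_term M \<alpha>) ts) \<subseteq> universe M"
    by auto
  then show ?case using assms(1) unfolding is_struct_def by simp
qed

lemma shallow_linear_FunE:
  assumes "shallow (Fun f ts)" "linear (Fun f ts)"
  obtains xs where "ts = map Var xs" "distinct xs"
proof -
  have "\<exists>xs. ts = map Var xs"
    using assms(1) by (simp add: ex_map_conv)
  then obtain xs where xs: "ts = map Var xs" by blast
  have "concat (map var_occs ts) = xs"
    unfolding xs by (induction xs) auto
  then show thesis using that[OF xs] assms(2) by (simp add: linear_def)
qed

lemma mslh_clause_atom:
  assumes "mslh_clause C" "L \<in># C"
  obtains P t where "atom_of L = Atom P [t]"
proof -
  obtain P ts where A: "atom_of L = Atom P ts" by (cases "atom_of L")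
  have "length ts = 1"
    using assms A unfolding mslh_clause_def monadic_def by force
  then show thesis using that A by (cases ts) auto
qed

lemma mslh_clause_head_unique:
  assumes "mslh_clause C" "Pos A \<in># C" "Pos B \<in># C"
  shows "A = B"
proof -
  have "A \<in># succedent C" "B \<in># succedent C"
    using assms(2,3) by (force simp: succedent_def)+
  moreover have "size (succedent C) \<le> 1"
    using assms(1) by (simp add: mslh_clause_def)
  ultimately show ?thesis
    by (cases "succedent C") auto
qed

lemma mslh_clause_head:
  assumes "mslh_clause C" "Pos (Atom Q [s]) \<in># C"
  shows "shallow s" "linear s"
proof -
  have "Atom Q [s] \<in># succedent C"
    using assms(2) by (force simp: succedent_def)
  then show "shallow s" "linear s"
    using assms(1) by (force simp: mslh_clause_def)+
qed

text \<open>
  Terms with variables serve as the Herbrand universe: the variables act as additional constants,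
  so that it is nonempty even if there are no constant symbols.
\<close>

inductive derivable :: "('f, 'p, 'v) clause set \<Rightarrow> 'p \<Rightarrow> ('f, 'v) fo_term \<Rightarrow> bool" for N where
  resolve_step: "\<lbrakk>C \<in> N; Pos (Atom Q [s]) \<in># C;
    \<And>P u. Neg (Atom P [u]) \<in># C \<Longrightarrow> derivable N P (subst \<sigma> u)\<rbrakk>
   \<Longrightarrow> derivable N Q (subst \<sigma> s)"

lemma derivable_in_preds: "derivable N Q t \<Longrightarrow> Q \<in> preds N"
  by (induction rule: derivable.induct) (force simp: preds_def)

text \<open>Each derivation step instantiates a clause that is true in \<open>M\<close>. By
  induction its negative literals fail under the assignment induced by \<open>\<sigma>\<close>, and
  by the Horn condition the only positive literal is the head.\<close>

lemma derivable_sound: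
  assumes N: "mslh_clause_set N" and M: "is_model M N" and \<alpha>: "range \<alpha> \<subseteq> universe M"
  shows "derivable N Q t \<Longrightarrow> pred_interp M Q [eval_term M \<alpha> t]"
proof (induction rule: derivable.induct)
  case (resolve_step C Q s \<sigma>)
  let ?\<beta> = "\<lambda>x. eval_term M \<alpha> (\<sigma> x)"
  have C: "mslh_clause C" using N resolve_step.hyps by (simp add: mslh_clause_set_def)
  have "range ?\<beta> \<subseteq> universe M"
    using eval_term_in_universe M \<alpha> by (fastforce simp: is_model_def)
  then obtain L where L: "L \<in># C" "sat_literal M ?\<beta> L"
    using M resolve_step.hyps unfolding is_model_def sat_clause_def by meson
  obtain P t where A: "atom_of L = Atom P [t]"
    using mslh_clause_atom[OF C L(1)] .
  show ?case
  proof (cases L)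
    case (Pos B)
    then have "B = Atom Q [s]"
      using mslh_clause_head_unique[OF C] L resolve_step.hyps by blast
    then show ?thesis using Pos L(2) by (simp add: sat_atom_def eval_term_subst)
  next
    case (Neg B)
    then show ?thesis using A L resolve_step.IH[of P t]
      by (simp add: sat_atom_def eval_term_subst)
  qed
qed

text \<open>Call the set of predicates derivable for a term its type. Closing type inclusion under
  function application allows replacements at any depth, as the arbitrary terms in clause bodies
  require. That the closure still implies type inclusion is the key fact about MSLH clauses.\<close>

inductive type_le :: "('f, 'p, 'v) clause set \<Rightarrow> ('f, 'v) fo_term \<Rightarrow> ('f, 'v) fo_term \<Rightarrow> bool"
  for N where
  base: "(\<And>P. derivable N P t \<Longrightarrow> derivable N P t') \<Longrightarrow> type_le N t t'"
| cong: "list_all2 (type_le N) ts ts' \<Longrightarrow> type_le N (Fun f ts) (Fun f ts')"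

lemma type_le_subst:
  assumes "\<And>x. type_le N (\<sigma> x) (\<tau> x)"
  shows "type_le N (subst \<sigma> t) (subst \<tau> t)"
proof (induction t)
  case (Var x)
  then show ?case using assms by simp
next
  case (Fun f ts)
  then show ?case by (auto intro!: type_le.cong simp: list_all2_conv_all_nth)
qed

text \<open>This is applied to the head \<open>s\<close> of the last derivation step. Replacements
  strictly below the root of \<open>Fun f ts\<close> only change values of variables, as
  \<open>s\<close> is shallow, and never give one variable two values, as \<open>s\<close> is
  linear.\<close>

lemma type_le_instance:
  assumes "shallow s" "linear s" "type_le N (subst \<sigma> s) t"
  obtains
    (below) "\<And>P. derivable N P (subst \<sigma> s) \<Longrightarrow> derivable N P t"
  | (subst_inst) \<tau> where "t = subst \<tau> s" "\<And>x. type_le N (\<sigma> x) (\<tau> x)"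
proof (cases s)
  case (Var x)
  \<comment> \<open>A variable head matches every term: redirect \<open>x\<close> to
    \<open>t\<close> and use reflexivity at all other variables.\<close>
  have "type_le N (\<sigma> y) ((\<sigma>(x := t)) y)" for y
    using assms(3) Var by (auto intro: type_le.base)
  then show thesis using subst_inst[of "\<sigma>(x := t)"] Var by simp
next
  case (Fun f ts)
  obtain xs where xs: "ts = map Var xs" "distinct xs"
    using shallow_linear_FunE assms(1,2) Fun by metis
  from assms(3) show thesis
  proof cases
    case base
    then show thesis using below by blast
  next
    case (cong us us' g)
    have us: "us = map \<sigma> xs" using cong(1) Fun xs(1) by (simp add: o_def)
    have len: "length us' = length xs"
      using list_all2_lengthD[OF cong(3)] us by simp
    \<comment> \<open>Variables outside the head may occur in the clause body; they keep their value
      under \<open>\<sigma>\<close>, so that the two substitutions are related everywhere.\<close>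
    define \<tau> where "\<tau> x = (case map_of (zip xs us') x of Some u \<Rightarrow> u | None \<Rightarrow> \<sigma> x)" for x
    have nth: "\<tau> (xs ! i) = us' ! i" if "i < length xs" for i
      using that len xs(2) by (simp add: \<tau>_def map_of_zip_nth)
    have "map \<tau> xs = us'" using len nth by (auto intro: nth_equalityI)
    then have "t = subst \<tau> s" using cong(1,2) Fun xs(1) by (simp add: o_def)
    moreover have "type_le N (\<sigma> x) (\<tau> x)" for x
    proof (cases "x \<in> set xs")
      case True
      then obtain i where "i < length xs" "x = xs ! i" by (metis in_set_conv_nth)
      then show ?thesis using nth list_all2_nthD[OF cong(3), of i] us by simp
    next
      case False
      then have "map_of (zip xs us') x = None" using len by simp
      then show ?thesis by (simp add: \<tau>_def type_le.base)
    qed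
    ultimately show thesis using subst_inst by blast
  qed
qed

lemma derivable_type_le:
  assumes "mslh_clause_set N"
  shows "derivable N Q t \<Longrightarrow> type_le N t t' \<Longrightarrow> derivable N Q t'"
proof (induction arbitrary: t' rule: derivable.induct)
  case (resolve_step C Q s \<sigma>)
  have "mslh_clause C" using assms resolve_step.hyps by (simp add: mslh_clause_set_def)
  from mslh_clause_head[OF this resolve_step.hyps(2)] show ?case using resolve_step.prems
  proof (cases rule: type_le_instance)
    case below
    then show ?thesis using derivable.resolve_step[OF resolve_step.hyps] by blast
  next
    case (subst_inst \<tau>)
    \<comment> \<open>Body terms may be deep and nonlinear, but replacing \<open>\<sigma>\<close> by
      \<open>\<tau>\<close> throughout keeps them related, so the induction hypothesis turns the old
      premises into premises for the same clause under \<open>\<tau>\<close>.\<close>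
    have "derivable N P (subst \<tau> u)" if "Neg (Atom P [u]) \<in># C" for P u
      by (intro resolve_step.IH[OF that] type_le_subst subst_inst(2))
    then show ?thesis using derivable.resolve_step[OF resolve_step.hyps(1,2)] subst_inst(1) by blast
  qed
qed

lemma derivable_cong:
  assumes "mslh_clause_set N" and "list_all2 (\<lambda>t t'. \<forall>P. derivable N P t \<longleftrightarrow> derivable N P t') ts ts'"
  shows "derivable N Q (Fun f ts) \<longleftrightarrow> derivable N Q (Fun f ts')"
proof -
  have "type_le N (Fun f ts) (Fun f ts')" "type_le N (Fun f ts') (Fun f ts)"
    using assms(2) by (fastforce intro: type_le.cong type_le.base simp: list_all2_conv_all_nth)+
  then show ?thesis using derivable_type_le[OF assms(1)] by blast
qed

text \<open>The derivable atoms form a Herbrand model. Clauses with a head hold by closure under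
  \<open>resolve_step\<close>; a violated clause without a head would, by soundness, be violated in
  \<open>M\<close> too.\<close>

lemma derivable_satisfies:
  assumes N: "mslh_clause_set N" and M: "is_model M N" and C: "C \<in> N"
  shows "(\<exists>P u. Neg (Atom P [u]) \<in># C \<and> \<not> derivable N P (subst \<sigma> u)) \<or>
    (\<exists>Q s. Pos (Atom Q [s]) \<in># C \<and> derivable N Q (subst \<sigma> s))"
proof (rule ccontr)
  assume neg: "\<not> ?thesis"
  have mslh: "mslh_clause C" using N C by (simp add: mslh_clause_set_def)
  \<comment> \<open>The variables inside Herbrand terms also need values in \<open>M\<close>; one
    constant assignment suffices.\<close>
  obtain a where a: "a \<in> universe M"
    using M by (auto simp: is_model_def is_struct_def)
  let ?\<alpha> = "\<lambda>_. a"
  let ?\<beta> = "\<lambda>x. eval_term M ?\<alpha> (\<sigma> x)"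
  have \<alpha>: "range ?\<alpha> \<subseteq> universe M" using a by auto
  then have "range ?\<beta> \<subseteq> universe M"
    using eval_term_in_universe M by (fastforce simp: is_model_def)
  then obtain L where L: "L \<in># C" "sat_literal M ?\<beta> L"
    using M C unfolding is_model_def sat_clause_def by meson
  obtain P t where A: "atom_of L = Atom P [t]"
    using mslh_clause_atom[OF mslh L(1)] .
  show False
  proof (cases L)
    case (Pos B)
    then show False using neg derivable.resolve_step[OF C, of P t \<sigma>] L(1) A by auto
  next
    case (Neg B)
    then have "derivable N P (subst \<sigma> t)" using neg L(1) A by auto
    from derivable_sound[OF N M \<alpha> this] show False
      using Neg L(2) A by (simp add: sat_atom_def eval_term_subst)
  qed
qed

theorem theorem7:
  fixes N :: "('f, 'p, 'v) clause set"
  assumes "finite N"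
    and "mslh_clause_set N"
    and "\<exists>M :: ('f, 'p, 'u) struct. is_model M N"
  shows "\<exists>M :: ('f, 'p, nat) struct.
           is_model M N \<and> finite (universe M) \<and> card (universe M) \<le> 2 ^ card (preds N)"
proof -
  obtain M0 :: "('f, 'p, 'u) struct" where M0: "is_model M0 N" using assms(3) by blast
  define T where "T t = {P. derivable N P t}" for t :: "('f, 'v) fo_term"
  have "preds N = (\<Union>C\<in>N. (\<lambda>L. pred_of (atom_of L)) ` set_mset C)"
    by (auto simp: preds_def)
  then have fin_preds: "finite (preds N)" using assms(1) by simp
  have T_sub: "range T \<subseteq> Pow (preds N)"
    using derivable_in_preds by (force simp: T_def)
  then have fin_T: "finite (range T)" using fin_preds by (simp add: finite_subset)
  \<comment> \<open>Domain elements are natural numbers coding the finitely many types.\<close>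
  obtain e :: "'p set \<Rightarrow> nat" where e: "inj_on e (range T)"
    using finite_imp_inj_to_nat_seg[OF fin_T] by metis
  define h where "h t = e (T t)" for t
  have h_eq: "h t = h t' \<longleftrightarrow> (\<forall>P. derivable N P t \<longleftrightarrow> derivable N P t')" for t t'
    unfolding h_def inj_on_eq_iff[OF e rangeI rangeI] by (auto simp: T_def set_eq_iff)
  \<comment> \<open>\<open>r\<close> picks a representative term for each coded type.\<close>
  define r where "r = inv h"
  have h_r: "h (r u) = u" if "u \<in> range h" for u
    using that by (simp add: r_def f_inv_into_f)
  define M where "M = \<lparr>universe = range h, fun_interp = \<lambda>f us. h (Fun f (map r us)),
    pred_interp = \<lambda>P us. \<exists>t. us = [h t] \<and> derivable N P t\<rparr>"
  \<comment> \<open>\<open>r (h t)\<close> may differ from \<open>t\<close> but has the same type,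
    so by congruence the choice of representatives does not matter and \<open>h\<close> is a
    homomorphism from terms to \<open>M\<close>.\<close>
  have h_Fun: "fun_interp M f (map h ts) = h (Fun f ts)" for f ts
  proof -
    have "list_all2 (\<lambda>t t'. \<forall>P. derivable N P t \<longleftrightarrow> derivable N P t') (map r (map h ts)) ts"
      using h_r by (simp add: list_all2_conv_all_nth flip: h_eq)
    from derivable_cong[OF assms(2) this] show ?thesis by (simp add: M_def h_eq)
  qed
  have eval: "eval_term M (\<lambda>x. h (\<sigma> x)) t = h (subst \<sigma> t)" for \<sigma> and t :: "('f, 'v) fo_term"
  proof (induction t)
    case (Fun f ts)
    then have "map (eval_term M (\<lambda>x. h (\<sigma> x))) ts = map h (map (subst \<sigma>) ts)" by simp
    then show ?case by (simp only: eval_term.simps subst.simps h_Fun)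
  qed simp
  have sat: "sat_atom M (\<lambda>x. h (\<sigma> x)) (Atom P [u]) \<longleftrightarrow> derivable N P (subst \<sigma> u)"
    for \<sigma> P and u :: "('f, 'v) fo_term"
  proof -
    have "pred_interp M P [h t] \<longleftrightarrow> derivable N P t" for t
      by (auto simp: M_def h_eq)
    then show ?thesis by (simp add: sat_atom_def eval)
  qed
  have "sat_clause M C" if C: "C \<in> N" for C
    unfolding sat_clause_def
  proof (intro allI impI)
    fix \<alpha> :: "'v \<Rightarrow> nat"
    assume \<alpha>: "range \<alpha> \<subseteq> universe M"
    \<comment> \<open>Lifting the assignment to representatives makes truth in \<open>M\<close>
      coincide with derivability of the instance under \<open>\<sigma>\<close>.\<close>
    define \<sigma> where "\<sigma> x = r (\<alpha> x)" for x
    have "h (\<sigma> x) = \<alpha> x" for x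
      using \<alpha> unfolding \<sigma>_def by (intro h_r) (auto simp: M_def)
    then have sat': "sat_atom M \<alpha> (Atom P [u]) \<longleftrightarrow> derivable N P (subst \<sigma> u)" for P u
      using sat[of \<sigma>] by simp
    show "\<exists>L\<in>#C. sat_literal M \<alpha> L"
      using derivable_satisfies[OF assms(2) M0 C, of \<sigma>]
      by (metis sat' sat_literal.simps)
  qed
  moreover have "is_struct M" by (simp add: is_struct_def M_def)
  ultimately have "is_model M N" by (simp add: is_model_def)
  \<comment> \<open>There is one element per type that occurs, and every type is a subset of
    \<open>preds N\<close>.\<close>
  moreover have "universe M = e ` range T" by (auto simp: M_def h_def)
  moreover have "card (e ` range T) \<le> 2 ^ card (preds N)"
  proof -
    have "card (e ` range T) \<le> card (range T)" using fin_T by (rule card_image_le)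
    also have "\<dots> \<le> card (Pow (preds N))" using T_sub fin_preds by (intro card_mono) auto
    finally show ?thesis using fin_preds by (simp add: card_Pow)
  qed
  ultimately show ?thesis using fin_T by (metis finite_imageI)
qed

end
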